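(* For every formula $\varphi$ and every database $M$, $$\pi_{gen_0(\varphi)}(\|\varphi\|_M)\subseteq \mathrm A(M)^{gen_0(\varphi)}\quad\text{and}\quad \pi_{cogen_0(\varphi)}(\overline{\|\varphi\|_M})\subseteq \mathrm A(M)^{cogen_0(\varphi)}.$$
   Context: Language: finite set $\mathcal R$ of relation symbols with arities $\delta(r)$; finite set $\mathcal X$ of variables. Formulas: $1$; $r(x_1,\ldots,x_n)$; $(x\approx y)$; $\neg\varphi$; $\varphi\wedge\psi$; $\varphi\vee\psi$; $(\exists x)\varphi$. A database (structure) $M$: nonempty finite set $M$ with $r^M\subseteq M^{\delta(r)}$. $\mathcal V=M^{\mathcal X}$, $\overline V=\mathcal V\setminus V$, $\mathrm C_x(V)=\{v:\exists u\in V,\ u(y)=v(y)\ \forall y\neq x\}$, $\mathrm D_{xy}=\{v:v(x)=v(y)\}$. Value: $\|1\|=\mathcal V$, $\|r(x_1,\ldots,x_n)\|=\{v:(v(x_1),\ldots,v(x_n))\in r^M\}$, $\|x\approx y\|=\mathrm D_{xy}$, $\|\neg\varphi\|=\overline{\|\varphi\|}$, $\wedge\mapsto\cap$, $\vee\mapsto\cup$, $\|(\exists x)\varphi\|=\mathrm C_x(\|\varphi\|)$. For $V\subseteq\mathcal V$ and $X\subseteq\mathcal X$, $\pi_X(V)=\{v|_X:v\in V\}$. The active domain $\mathrm A(M)$ is the set of all elements of $M$ occurring as a component of some tuple of some $r^M$, $r\in\mathcal R$. In the following recursive definitions $\varphi\vee\psi$ is treated as $\neg(\neg\varphi\wedge\neg\psi)$.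 $\mathrm{Eq}(R)$ is the least equivalence on $\mathcal X$ containing $R$; $\mathrm{id}_{\mathcal X}$ the identity. $eq(1)=coeq(1)=eq(r(\ldots))=coeq(r(\ldots))=coeq(x\approx y)=\mathrm{id}_{\mathcal X}$, $eq(x_1\approx x_2)=\mathrm{Eq}(\{\langle x_1,x_2\rangle\})$; $eq(\neg\varphi)=coeq(\varphi)$, $coeq(\neg\varphi)=eq(\varphi)$; $eq(\varphi\wedge\psi)=\mathrm{Eq}(eq(\varphi)\cup eq(\psi))$, $coeq(\varphi\wedge\psi)=coeq(\varphi)\cap coeq(\psi)$; $eq((\exists x)\varphi)=\mathrm{Eq}(eq(\varphi)\cap(\mathcal X\setminus\{x\})^2)$, likewise $coeq$. For an equivalence $E$, $\mathrm{cl}_E(X)=\{y:\langle x,y\rangle\in E\text{ for some }x\in X\}$. $gen_0(1)=cogen_0(1)=\emptyset$; $gen_0(r(x_1,\ldots,x_n))=\{x_1,\ldots,x_n\}$, $cogen_0(r(\ldots))=\emptyset$; $gen_0(x\approx y)=cogen_0(x\approx y)=\emptyset$; $gen_0(\neg\varphi)=cogen_0(\varphi)$, $cogen_0(\neg\varphi)=gen_0(\varphi)$; $gen_0(\varphi\wedge\psi)=\mathrm{cl}_{eq(\varphi\wedge\psi)}(gen_0(\varphi)\cup gen_0(\psi))$, $cogen_0(\varphi\wedge\psi)=cogen_0(\varphi)\cap cogen_0(\psi)$; $gen_0((\exists x)\varphi)=gen_0(\varphi)\setminus\{x\}$, $cogen_0((\exists x)\varphi)=cogen_0(\varphi)\setminus\{x\}$.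 *)

theory Defs
  imports "HOL-Library.FuncSet"
begin

text \<open>
  A language is given by a finite set \<open>R\<close> of relation symbols with an arity function \<open>\<delta>\<close> and a
  finite set \<open>X\<close> of variables; these are explicit parameters (carrier sets in arbitrary types)
  throughout. Tuples are lists.
\<close>

datatype ('r, 'x) formula =
    Truth
  | Atom 'r "'x list"
  | Equal 'x 'x
  | Neg "('r, 'x) formula"
  | Conj "('r, 'x) formula" "('r, 'x) formula"
  | Disj "('r, 'x) formula" "('r, 'x) formula"
  | Exists 'x "('r, 'x) formula"

primrec wf_formula :: "'r set \<Rightarrow> ('r \<Rightarrow> nat) \<Rightarrow> 'x set \<Rightarrow> ('r, 'x) formula \<Rightarrow> bool" where
  "wf_formula R \<delta> X Truth \<longleftrightarrow> True"
| "wf_formula R \<delta> X (Atom r xs) \<longleftrightarrow> r \<in> R \<and> length xs = \<delta> r \<and> set xs \<subseteq> X"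
| "wf_formula R \<delta> X (Equal x y) \<longleftrightarrow> x \<in> X \<and> y \<in> X"
| "wf_formula R \<delta> X (Neg \<phi>) \<longleftrightarrow> wf_formula R \<delta> X \<phi>"
| "wf_formula R \<delta> X (Conj \<phi> \<psi>) \<longleftrightarrow> wf_formula R \<delta> X \<phi> \<and> wf_formula R \<delta> X \<psi>"
| "wf_formula R \<delta> X (Disj \<phi> \<psi>) \<longleftrightarrow> wf_formula R \<delta> X \<phi> \<and> wf_formula R \<delta> X \<psi>"
| "wf_formula R \<delta> X (Exists x \<phi>) \<longleftrightarrow> x \<in> X \<and> wf_formula R \<delta> X \<phi>"

record ('r, 'm) struct =
  univ :: "'m set"
  interp :: "'r \<Rightarrow> 'm list set"

definition database :: "'r set \<Rightarrow> ('r \<Rightarrow> nat) \<Rightarrow> ('r, 'm) struct \<Rightarrow> bool" where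
  "database R \<delta> M \<longleftrightarrow> finite (univ M) \<and> univ M \<noteq> {} \<and>
     (\<forall>r\<in>R. interp M r \<subseteq> {t. length t = \<delta> r \<and> set t \<subseteq> univ M})"

definition active_dom :: "'r set \<Rightarrow> ('r, 'm) struct \<Rightarrow> 'm set" where
  "active_dom R M = (\<Union>r\<in>R. \<Union>t\<in>interp M r. set t)"

definition valuations :: "'x set \<Rightarrow> ('r, 'm) struct \<Rightarrow> ('x \<Rightarrow> 'm) set" where
  "valuations X M = (X \<rightarrow>\<^sub>E univ M)"

definition cylind ::
  "'x set \<Rightarrow> ('r, 'm) struct \<Rightarrow> 'x \<Rightarrow> ('x \<Rightarrow> 'm) set \<Rightarrow> ('x \<Rightarrow> 'm) set" where
  "cylind X M x V = {v \<in> valuations X M. \<exists>u\<in>V. \<forall>y\<in>X. y \<noteq> x \<longrightarrow> u y = v y}"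

definition diag :: "'x set \<Rightarrow> ('r, 'm) struct \<Rightarrow> 'x \<Rightarrow> 'x \<Rightarrow> ('x \<Rightarrow> 'm) set" where
  "diag X M x y = {v \<in> valuations X M. v x = v y}"

primrec val :: "'x set \<Rightarrow> ('r, 'm) struct \<Rightarrow> ('r, 'x) formula \<Rightarrow> ('x \<Rightarrow> 'm) set" where
  "val X M Truth = valuations X M"
| "val X M (Atom r xs) = {v \<in> valuations X M. map v xs \<in> interp M r}"
| "val X M (Equal x y) = diag X M x y"
| "val X M (Neg \<phi>) = valuations X M - val X M \<phi>"
| "val X M (Conj \<phi> \<psi>) = val X M \<phi> \<inter> val X M \<psi>"
| "val X M (Disj \<phi> \<psi>) = val X M \<phi> \<union> val X M \<psi>"
| "val X M (Exists x \<phi>) = cylind X M x (val X M \<phi>)"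

definition proj :: "'x set \<Rightarrow> ('x \<Rightarrow> 'm) set \<Rightarrow> ('x \<Rightarrow> 'm) set" where
  "proj Y V = (\<lambda>v. restrict v Y) ` V"

text \<open>
  The least equivalence on \<open>X\<close> containing \<open>S\<close>; meaningful for \<open>S \<subseteq> X \<times> X\<close>, the only case that
  arises from well-formed formulas.
\<close>
definition Eq_gen :: "'x set \<Rightarrow> ('x \<times> 'x) set \<Rightarrow> ('x \<times> 'x) set" where
  "Eq_gen X S = \<Inter>{E. equiv X E \<and> S \<subseteq> E}"

text \<open>
  A weight under which \<open>Neg (Conj (Neg \<phi>) (Neg \<psi>))\<close> is smaller than \<open>Disj \<phi> \<psi>\<close>, so that
  disjunctions may be rewritten in the recursions below.
\<close>
primrec weight :: "('r, 'x) formula \<Rightarrow> nat" where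
  "weight Truth = 0"
| "weight (Atom r xs) = 0"
| "weight (Equal x y) = 0"
| "weight (Neg \<phi>) = Suc (weight \<phi>)"
| "weight (Conj \<phi> \<psi>) = Suc (weight \<phi> + weight \<psi>)"
| "weight (Disj \<phi> \<psi>) = weight \<phi> + weight \<psi> + 5"
| "weight (Exists x \<phi>) = Suc (weight \<phi>)"

function fm_eq :: "'x set \<Rightarrow> ('r, 'x) formula \<Rightarrow> ('x \<times> 'x) set"
  and fm_coeq :: "'x set \<Rightarrow> ('r, 'x) formula \<Rightarrow> ('x \<times> 'x) set" where
  "fm_eq X Truth = Id_on X"
| "fm_eq X (Atom r xs) = Id_on X"
| "fm_eq X (Equal x y) = Eq_gen X {(x, y)}"
| "fm_eq X (Neg \<phi>) = fm_coeq X \<phi>"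
| "fm_eq X (Conj \<phi> \<psi>) = Eq_gen X (fm_eq X \<phi> \<union> fm_eq X \<psi>)"
| "fm_eq X (Disj \<phi> \<psi>) = fm_eq X (Neg (Conj (Neg \<phi>) (Neg \<psi>)))"
| "fm_eq X (Exists x \<phi>) = Eq_gen X (fm_eq X \<phi> \<inter> (X - {x}) \<times> (X - {x}))"
| "fm_coeq X Truth = Id_on X"
| "fm_coeq X (Atom r xs) = Id_on X"
| "fm_coeq X (Equal x y) = Id_on X"
| "fm_coeq X (Neg \<phi>) = fm_eq X \<phi>"
| "fm_coeq X (Conj \<phi> \<psi>) = fm_coeq X \<phi> \<inter> fm_coeq X \<psi>"
| "fm_coeq X (Disj \<phi> \<psi>) = fm_coeq X (Neg (Conj (Neg \<phi>) (Neg \<psi>)))"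
| "fm_coeq X (Exists x \<phi>) = Eq_gen X (fm_coeq X \<phi> \<inter> (X - {x}) \<times> (X - {x}))"
  by pat_completeness auto
termination
  by (relation "measure (case_sum (weight \<circ> snd) (weight \<circ> snd))") auto

text \<open>\<open>E `` Y\<close> is the closure of \<open>Y\<close> under the equivalence \<open>E\<close>.\<close>
function gen0 :: "'x set \<Rightarrow> ('r, 'x) formula \<Rightarrow> 'x set"
  and cogen0 :: "'x set \<Rightarrow> ('r, 'x) formula \<Rightarrow> 'x set" where
  "gen0 X Truth = {}"
| "gen0 X (Atom r xs) = set xs"
| "gen0 X (Equal x y) = {}"
| "gen0 X (Neg \<phi>) = cogen0 X \<phi>"
| "gen0 X (Conj \<phi> \<psi>) = fm_eq X (Conj \<phi> \<psi>) `` (gen0 X \<phi> \<union> gen0 X \<psi>)"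
| "gen0 X (Disj \<phi> \<psi>) = gen0 X (Neg (Conj (Neg \<phi>) (Neg \<psi>)))"
| "gen0 X (Exists x \<phi>) = gen0 X \<phi> - {x}"
| "cogen0 X Truth = {}"
| "cogen0 X (Atom r xs) = {}"
| "cogen0 X (Equal x y) = {}"
| "cogen0 X (Neg \<phi>) = gen0 X \<phi>"
| "cogen0 X (Conj \<phi> \<psi>) = cogen0 X \<phi> \<inter> cogen0 X \<psi>"
| "cogen0 X (Disj \<phi> \<psi>) = cogen0 X (Neg (Conj (Neg \<phi>) (Neg \<psi>)))"
| "cogen0 X (Exists x \<phi>) = cogen0 X \<phi> - {x}"
  by pat_completeness auto
termination
  by (relation "measure (case_sum (weight \<circ> snd) (weight \<circ> snd))") auto

end

theory Submission
  imports Defs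
begin

text \<open>
  Every valuation satisfying (falsifying) \<open>\<phi>\<close> identifies the variables related by \<open>eq(\<phi>)\<close>
  (\<open>coeq(\<phi>)\<close>), because its kernel is an equivalence and so contains the generated equivalences.
  Hence the value at a variable obtained by closing under \<open>eq\<close> is already a value at a variable
  known to range over the active domain.
\<close>

definition kernel_on :: "'x set \<Rightarrow> ('x \<Rightarrow> 'm) \<Rightarrow> ('x \<times> 'x) set" where
  "kernel_on X v = {(x, y). x \<in> X \<and> y \<in> X \<and> v x = v y}"

lemma equiv_kernel_on: "equiv X (kernel_on X v)"
  by (auto simp: equiv_def refl_on_def sym_def trans_def kernel_on_def)

lemma Eq_gen_subset_kernel_on: "S \<subseteq> kernel_on X v \<Longrightarrow> Eq_gen X S \<subseteq> kernel_on X v"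
  unfolding Eq_gen_def using equiv_kernel_on by blast

lemma Id_on_subset_kernel_on: "Id_on X \<subseteq> kernel_on X v"
  by (auto simp: kernel_on_def)

text \<open>Serves the quantifier case: a witness \<open>u\<close> and \<open>v\<close> differ at
  most at \<open>x\<close>, so identifications not involving \<open>x\<close> pass from
  \<open>u\<close> to \<open>v\<close>.\<close>

lemma kernel_on_agree_off:
  assumes "S \<subseteq> kernel_on X u" and "\<forall>y\<in>X. y \<noteq> x \<longrightarrow> u y = v y"
  shows "S \<inter> (X - {x}) \<times> (X - {x}) \<subseteq> kernel_on X v"
  using assms by (fastforce simp: kernel_on_def)

lemma val_subset_valuations: "val X M \<phi> \<subseteq> valuations X M"
  by (induction \<phi>) (auto simp: diag_def cylind_def)

text \<open>Every valuation in \<open>V\<close> witnesses its own membership in the cylinder. Thus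
  falsifying an existential formula falsifies its body at the same valuation.\<close>

lemma not_in_cylindD: "v \<in> valuations X M - cylind X M x V \<Longrightarrow> v \<in> valuations X M - V"
  by (auto simp: cylind_def)

text \<open>Both halves are proved together since negation swaps them; \<open>v\<close> is
  generalized so that the hypothesis applies to the witness of a quantifier.\<close>

lemma fm_eq_coeq_subset_kernel_on:
  assumes "wf_formula R \<delta> X \<phi>"
  shows "(v \<in> val X M \<phi> \<longrightarrow> fm_eq X \<phi> \<subseteq> kernel_on X v) \<and>
         (v \<in> valuations X M - val X M \<phi> \<longrightarrow> fm_coeq X \<phi> \<subseteq> kernel_on X v)"
  using assms
proof (induction \<phi> arbitrary: v)
  case (Equal x y)
  have "v \<in> val X M (Equal x y) \<Longrightarrow> {(x, y)} \<subseteq> kernel_on X v"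
    using Equal by (auto simp: diag_def kernel_on_def)
  then show ?case
    by (simp add: Eq_gen_subset_kernel_on Id_on_subset_kernel_on)
next
  case (Neg \<phi>)
  then show ?case
    \<comment> \<open>Needed for the double complement to return
      \<open>val X M \<phi>\<close>.\<close>
    using val_subset_valuations[of X M \<phi>] by auto
next
  case (Conj \<phi> \<psi>)
  \<comment> \<open>A falsified conjunction has a falsified conjunct, whose \<open>fm_coeq\<close>
    contains the intersection.\<close>
  then show ?case
    by (simp add: Eq_gen_subset_kernel_on) (blast intro: le_infI1 le_infI2)
next
  case (Disj \<phi> \<psi>)
  then show ?case
    by (simp add: Eq_gen_subset_kernel_on) (blast intro: le_infI1 le_infI2)
next
  case (Exists x \<phi>)
  have "fm_eq X (Exists x \<phi>) \<subseteq> kernel_on X v" if v: "v \<in> val X M (Exists x \<phi>)"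
  proof -
    obtain u where "u \<in> val X M \<phi>" and agree: "\<forall>y\<in>X. y \<noteq> x \<longrightarrow> u y = v y"
      using v by (auto simp: cylind_def)
    then have "fm_eq X \<phi> \<subseteq> kernel_on X u"
      using Exists by simp
    then show ?thesis
      using agree by (simp add: Eq_gen_subset_kernel_on kernel_on_agree_off)
  qed
  moreover have "fm_coeq X (Exists x \<phi>) \<subseteq> kernel_on X v"
    if v: "v \<in> valuations X M - val X M (Exists x \<phi>)"
  proof -
    have "fm_coeq X \<phi> \<subseteq> kernel_on X v"
      using v not_in_cylindD[of v X M x "val X M \<phi>"] Exists by simp
    then show ?thesis
      by (simp add: Eq_gen_subset_kernel_on le_infI1)
  qed
  ultimately show ?case by blast
qed (simp_all add: Id_on_subset_kernel_on)

text \<open>The kernel of a constant map is all of \<open>X \<times> X\<close>.\<close>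

lemma Eq_gen_subset: "S \<subseteq> X \<times> X \<Longrightarrow> Eq_gen X S \<subseteq> X \<times> X"
  using Eq_gen_subset_kernel_on[of S X "\<lambda>_. ()"] by (auto simp: kernel_on_def)

lemma fm_eq_coeq_subset:
  assumes "wf_formula R \<delta> X \<phi>"
  shows "fm_eq X \<phi> \<subseteq> X \<times> X \<and> fm_coeq X \<phi> \<subseteq> X \<times> X"
  using assms
proof (induction \<phi>)
  case (Exists x \<phi>)
  then have "fm_eq X \<phi> \<inter> (X - {x}) \<times> (X - {x}) \<subseteq> X \<times> X"
    and "fm_coeq X \<phi> \<inter> (X - {x}) \<times> (X - {x}) \<subseteq> X \<times> X"
    by auto
  then show ?case by (simp add: Eq_gen_subset)
qed (simp_all add: Eq_gen_subset Id_on_subset_Times le_infI1)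

text \<open>Quantifier witnesses agree with \<open>v\<close> only on variables in \<open>X\<close>,
  so the generated variables must be known to lie there.\<close>

lemma gen0_cogen0_subset:
  assumes "wf_formula R \<delta> X \<phi>"
  shows "gen0 X \<phi> \<subseteq> X \<and> cogen0 X \<phi> \<subseteq> X"
  using assms
proof (induction \<phi>)
  case (Conj \<phi> \<psi>)
  then show ?case
    using fm_eq_coeq_subset[of R \<delta> X "Conj \<phi> \<psi>"] by auto
next
  case (Disj \<phi> \<psi>)
  then show ?case
    using fm_eq_coeq_subset[of R \<delta> X "Disj \<phi> \<psi>"] by auto
qed auto

lemma image_kernel_on_closure:
  assumes "E \<subseteq> kernel_on X v" and "v ` Y \<subseteq> A"
  shows "v ` (E `` Y) \<subseteq> A"
  using assms by (fastforce simp: kernel_on_def)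

lemma gen0_cogen0_active:
  assumes "wf_formula R \<delta> X \<phi>"
  shows "(v \<in> val X M \<phi> \<longrightarrow> v ` gen0 X \<phi> \<subseteq> active_dom R M) \<and>
         (v \<in> valuations X M - val X M \<phi> \<longrightarrow> v ` cogen0 X \<phi> \<subseteq> active_dom R M)"
  using assms
proof (induction \<phi> arbitrary: v)
  case (Atom r xs)
  \<comment> \<open>A satisfying \<open>v\<close> sends \<open>xs\<close> to a tuple of
    \<open>interp M r\<close>, with \<open>r \<in> R\<close> by well-formedness.\<close>
  then show ?case by (force simp: active_dom_def)
next
  case (Neg \<phi>)
  then show ?case
    using val_subset_valuations[of X M \<phi>] by auto
next
  case (Conj \<phi> \<psi>)
  have "v ` gen0 X (Conj \<phi> \<psi>) \<subseteq> active_dom R M" if v: "v \<in> val X M (Conj \<phi> \<psi>)"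
    unfolding gen0.simps
  proof (rule image_kernel_on_closure)
    show "fm_eq X (Conj \<phi> \<psi>) \<subseteq> kernel_on X v"
      using fm_eq_coeq_subset_kernel_on Conj.prems v by blast
    show "v ` (gen0 X \<phi> \<union> gen0 X \<psi>) \<subseteq> active_dom R M"
      using Conj v by (simp add: image_Un)
  qed
  moreover have "v ` cogen0 X (Conj \<phi> \<psi>) \<subseteq> active_dom R M"
    if "v \<in> valuations X M - val X M (Conj \<phi> \<psi>)"
    \<comment> \<open>Whichever conjunct fails, its \<open>cogen0\<close> contains the
      intersection.\<close>
    using Conj that by (simp add: image_subset_iff) blast
  ultimately show ?case by blast
next
  case (Disj \<phi> \<psi>)
  have "v ` cogen0 X (Disj \<phi> \<psi>) \<subseteq> active_dom R M"
    if v: "v \<in> valuations X M - val X M (Disj \<phi> \<psi>)"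
    unfolding gen0.simps cogen0.simps
  proof (rule image_kernel_on_closure)
    \<comment> \<open>By De Morgan, \<open>cogen0\<close> of the disjunction is \<open>gen0\<close>
      of this conjunction, and the closing relation is
      \<open>fm_coeq X (Disj \<phi> \<psi>)\<close>.\<close>
    show "fm_eq X (Conj (Neg \<phi>) (Neg \<psi>)) \<subseteq> kernel_on X v"
      using fm_eq_coeq_subset_kernel_on[of R \<delta> X "Disj \<phi> \<psi>" v M] Disj.prems v by simp
    show "v ` (cogen0 X \<phi> \<union> cogen0 X \<psi>) \<subseteq> active_dom R M"
      using Disj v by (simp add: image_Un)
  qed
  moreover have "v ` gen0 X (Disj \<phi> \<psi>) \<subseteq> active_dom R M" if "v \<in> val X M (Disj \<phi> \<psi>)"
    using Disj that by (simp add: image_subset_iff) blast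
  ultimately show ?case by blast
next
  case (Exists x \<phi>)
  have "v ` gen0 X (Exists x \<phi>) \<subseteq> active_dom R M" if v: "v \<in> val X M (Exists x \<phi>)"
  proof -
    obtain u where u: "u \<in> val X M \<phi>" and agree: "\<forall>y\<in>X. y \<noteq> x \<longrightarrow> u y = v y"
      using v by (auto simp: cylind_def)
    \<comment> \<open>The variable \<open>x\<close>, where \<open>u\<close> and \<open>v\<close> may
      differ, has been removed from this set.\<close>
    have "v ` gen0 X (Exists x \<phi>) = u ` gen0 X (Exists x \<phi>)"
      using agree gen0_cogen0_subset[OF Exists.prems] by (intro image_cong) auto
    also have "\<dots> \<subseteq> active_dom R M"
      using Exists u by (simp add: image_subset_iff)
    finally show ?thesis .
  qed
  moreover have "v ` cogen0 X (Exists x \<phi>) \<subseteq> active_dom R M"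
    if v: "v \<in> valuations X M - val X M (Exists x \<phi>)"
    using v not_in_cylindD[of v X M x "val X M \<phi>"] Exists by (simp add: image_subset_iff)
  ultimately show ?case by blast
qed simp_all

text \<open>Restrictions to \<open>Y\<close> are extensional by construction, so only their range
  matters.\<close>

lemma proj_subset_PiE:
  assumes "\<And>v. v \<in> V \<Longrightarrow> v ` Y \<subseteq> A"
  shows "proj Y V \<subseteq> (Y \<rightarrow>\<^sub>E A)"
  using assms by (fastforce simp: proj_def)

theorem theorem5p6:
  fixes R :: "'r set" and \<delta> :: "'r \<Rightarrow> nat" and X :: "'x set"
    and \<phi> :: "('r, 'x) formula" and M :: "('r, 'm) struct"
  assumes "finite R" and "finite X"
    and "wf_formula R \<delta> X \<phi>"
    and "database R \<delta> M"
  shows "proj (gen0 X \<phi>) (val X M \<phi>) \<subseteq> (gen0 X \<phi> \<rightarrow>\<^sub>E active_dom R M) \<and>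
         proj (cogen0 X \<phi>) (valuations X M - val X M \<phi>) \<subseteq> (cogen0 X \<phi> \<rightarrow>\<^sub>E active_dom R M)"
  using gen0_cogen0_active[OF assms(3)] by (intro conjI proj_subset_PiE) blast+

end
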